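(* Let $S$ be an infinite set, let $\epsilon\colon S\to S$ be an idempotent function ($\epsilon\circ\epsilon=\epsilon$), and let $\alpha\colon S\to S$ be a function commuting with $\epsilon$. Let $\Phi=\Phi_\alpha^{\epsilon}\colon C_\epsilon\to C_\epsilon$ be the map induced by $\alpha$ on the set $C_\epsilon$ of connected components of $\epsilon$, and suppose that its functional digraph $D_\Phi$ has a component of type rro. Then $\alpha$ is a Cayley function if $D_\Phi$ has a component of type rro such that: (1) it is the join of a maximal right ray $R=[x_0\,x_1\,x_2\ldots\rangle$ and its branches; and (2) for every $i\ge 1$, if $[y_0\,y_1\ldots y_m=x_i]$ is a branch of $R$, then $m\le i$.
   Context: Cayley function: a function $\alpha\colon S\to S$ is a Cayley function if there are an associative binary operation $*$ on $S$ and an element $a\in S$ such that $\alpha(x)=a*x$ for all $x\in S$. Functional digraph: for a function $\beta\colon X\to X$ on a non-empty set $X$, $D_\beta$ is the directed graph with vertex set $X$ and an arc $x\to y$ exactly when $\beta(x)=y$. The component of $D_\beta$ containing $x$ is the subgraph induced by $\{y\in X:\beta^k(y)=\beta^m(x)\text{ for some integers }k,m\ge 0\}$. A vertex $x$ is initial if no $y\in X$ satisfies $y\to x$. For pairwise distinct vertices: a cycle of length $k\ge1$ is $x_0\to x_1\to\cdots\to x_{k-1}\to x_0$; a chain $[x_0\,x_1\ldots x_m]$ of length $m\geq 0$ is $x_0\to x_1\to\cdots\to x_m$; a right ray $[x_0\,x_1\,x_2\ldots\rangle$ is $x_0\to x_1\to x_2\to\cdots$; a double ray is $\cdots\to x_{-1}\to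 x_0\to x_1\to\cdots$. A right ray $[x_0\,x_1\ldots\rangle$ in $D_\beta$ is maximal if $x_0$ is an initial vertex of $D_\beta$. A component of $D_\beta$ is of type rro ("right rays only") if it has a right ray but no double ray (hence also no cycle). A branch of a maximal right ray $R$ is a chain $[y_0\,y_1\ldots y_m]$ with $m\ge1$ such that $y_0$ is an initial vertex of $D_\beta$, $y_m$ lies on $R$ and $y_{m-1}$ does not lie on $R$. The component is the join of $R$ and its branches if it is the union of $R$ and all branches of $R$. The map $\Phi_\alpha^\epsilon$: for an idempotent $\epsilon$ on $S$, $C_\epsilon$ is the set of connected components of $D_\epsilon$; each component $\gamma$ consists of one fixed point of $\epsilon$ together with all elements that $\epsilon$ maps to it. If $\alpha\epsilon=\epsilon\alpha$, then for each $\gamma\in C_\epsilon$ there is a unique $\delta\in C_\epsilon$ such that $\alpha$ maps every element (vertex) of $\gamma$ into $\delta$, and $\Phi_\alpha^\epsilon(\gamma)$ is defined to be this $\delta$. *)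

theory Defs
  imports "Graph_Theory.Graph_Theory" "HOL-Library.FuncSet"
begin

definition cayley_function :: "'a set \<Rightarrow> ('a \<Rightarrow> 'a) \<Rightarrow> bool" where
  "cayley_function S \<alpha> \<longleftrightarrow>
     (\<exists>mult :: 'a \<Rightarrow> 'a \<Rightarrow> 'a. \<exists>a\<in>S.
        (\<forall>x\<in>S. \<forall>y\<in>S. mult x y \<in> S) \<and>
        (\<forall>x\<in>S. \<forall>y\<in>S. \<forall>z\<in>S. mult (mult x y) z = mult x (mult y z)) \<and>
        (\<forall>x\<in>S. \<alpha> x = mult a x))"

definition functional_digraph :: "'v set \<Rightarrow> ('v \<Rightarrow> 'v) \<Rightarrow> ('v, 'v \<times> 'v) pre_digraph" where
  "functional_digraph X \<beta> = with_proj \<lparr> pverts = X, parcs = {(x, y). x \<in> X \<and> y \<in> X \<and> \<beta> x = y} \<rparr>"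

definition component_of :: "'v set \<Rightarrow> ('v \<Rightarrow> 'v) \<Rightarrow> 'v \<Rightarrow> ('v, 'v \<times> 'v) pre_digraph" where
  "component_of X \<beta> x =
     functional_digraph X \<beta> \<restriction> {y \<in> X. \<exists>k m. (\<beta> ^^ k) y = (\<beta> ^^ m) x}"

definition components :: "'v set \<Rightarrow> ('v \<Rightarrow> 'v) \<Rightarrow> ('v, 'v \<times> 'v) pre_digraph set" where
  "components X \<beta> = component_of X \<beta> ` X"

definition initial_vertex :: "('v, 'e) pre_digraph \<Rightarrow> 'v \<Rightarrow> bool" where
  "initial_vertex D x \<longleftrightarrow> x \<in> verts D \<and> \<not> (\<exists>y. y \<rightarrow>\<^bsub>D\<^esub> x)"

text \<open>The chain \<open>[y 0, \<dots>, y m]\<close> is given by a function \<open>y\<close>, of which only the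
  values at arguments up to \<open>m\<close> matter, together with its length \<open>m\<close>.\<close>

definition chain_in :: "('v, 'e) pre_digraph \<Rightarrow> (nat \<Rightarrow> 'v) \<Rightarrow> nat \<Rightarrow> bool" where
  "chain_in D y m \<longleftrightarrow> y ` {..m} \<subseteq> verts D \<and> inj_on y {..m} \<and> (\<forall>i<m. y i \<rightarrow>\<^bsub>D\<^esub> y (Suc i))"

definition right_ray :: "('v, 'e) pre_digraph \<Rightarrow> (nat \<Rightarrow> 'v) \<Rightarrow> bool" where
  "right_ray D r \<longleftrightarrow> range r \<subseteq> verts D \<and> inj r \<and> (\<forall>i. r i \<rightarrow>\<^bsub>D\<^esub> r (Suc i))"

definition double_ray :: "('v, 'e) pre_digraph \<Rightarrow> (int \<Rightarrow> 'v) \<Rightarrow> bool" where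
  "double_ray D r \<longleftrightarrow> range r \<subseteq> verts D \<and> inj r \<and> (\<forall>i. r i \<rightarrow>\<^bsub>D\<^esub> r (i + 1))"

definition maximal_right_ray :: "('v, 'e) pre_digraph \<Rightarrow> (nat \<Rightarrow> 'v) \<Rightarrow> bool" where
  "maximal_right_ray D r \<longleftrightarrow> right_ray D r \<and> initial_vertex D (r 0)"

definition type_rro :: "('v, 'e) pre_digraph \<Rightarrow> bool" where
  "type_rro C \<longleftrightarrow> (\<exists>r. right_ray C r) \<and> \<not> (\<exists>r. double_ray C r)"

definition branch :: "('v, 'e) pre_digraph \<Rightarrow> (nat \<Rightarrow> 'v) \<Rightarrow> (nat \<Rightarrow> 'v) \<Rightarrow> nat \<Rightarrow> bool" where
  "branch D r y m \<longleftrightarrow>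
     chain_in D y m \<and> m \<ge> 1 \<and> initial_vertex D (y 0) \<and> y m \<in> range r \<and> y (m - 1) \<notin> range r"

definition chain_digraph :: "(nat \<Rightarrow> 'v) \<Rightarrow> nat \<Rightarrow> ('v, 'v \<times> 'v) pre_digraph" where
  "chain_digraph y m = with_proj \<lparr> pverts = y ` {..m}, parcs = {(y i, y (Suc i)) |i. i < m} \<rparr>"

definition right_ray_digraph :: "(nat \<Rightarrow> 'v) \<Rightarrow> ('v, 'v \<times> 'v) pre_digraph" where
  "right_ray_digraph r = with_proj \<lparr> pverts = range r, parcs = {(r i, r (Suc i)) |i. True} \<rparr>"

definition join_of_branches ::
  "('v, 'v \<times> 'v) pre_digraph \<Rightarrow> (nat \<Rightarrow> 'v) \<Rightarrow> ('v, 'v \<times> 'v) pre_digraph" where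
  "join_of_branches D r =
     pre_digraph.Union D (insert (right_ray_digraph r) {chain_digraph y m |y m. branch D r y m})"

text \<open>The description is meaningful for an idempotent \<open>\<epsilon>\<close> on \<open>S\<close> commuting with \<open>\<alpha>\<close>:
  then exactly one such \<open>\<delta>\<close> exists for each component \<open>\<gamma>\<close>.\<close>

definition induced_map ::
  "'a set \<Rightarrow> ('a \<Rightarrow> 'a) \<Rightarrow> ('a \<Rightarrow> 'a) \<Rightarrow>
     ('a, 'a \<times> 'a) pre_digraph \<Rightarrow> ('a, 'a \<times> 'a) pre_digraph" where
  "induced_map S \<epsilon> \<alpha> \<gamma> = (THE \<delta>. \<delta> \<in> components S \<epsilon> \<and> \<alpha> ` verts \<gamma> \<subseteq> verts \<delta>)"

end

theory Submission
  imports Defs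
begin

text \<open>
  The conclusion rests on a grading. Suppose that a set \<open>P\<close> of elements of \<open>S\<close> satisfies
  \<open>x \<in> P \<longleftrightarrow> \<alpha> x \<in> P\<close> and carries a function \<open>l\<close> to the natural numbers with
  \<open>l (\<alpha> x) = l x + 1\<close>. Let the elements of \<open>P\<close> act as powers of \<open>\<alpha>\<close> and all others as left zeros:
  \<open>x * y = \<alpha>\<^bsup>l x\<^esup> y\<close> for \<open>x \<in> P\<close>, and \<open>x * y = x\<close> otherwise. This product is associative, because
  \<open>l (x * y) = l x + l y\<close> for \<open>x, y \<in> P\<close>, and every element of level 1 multiplies from the left as
  \<open>\<alpha>\<close> (lemma \<open>cayley_function_if_graded\<close>).

  The grading comes from the given component of \<open>D\<^sub>\<Phi>\<close>. A vertex \<open>d\<close> of that component eventually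
  enters the ray, say \<open>\<Phi>\<^bsup>k\<^esup> d = x\<^sub>i\<close>. The difference \<open>i - k\<close> depends on \<open>d\<close> alone, since the ray
  never repeats a vertex, and it grows by one along every arc. On the ray it is the index, and on a
  branch of length \<open>m\<close> that ends at \<open>x\<^sub>i\<close> its least value is \<open>i - m\<close>. So the bound \<open>m \<le> i\<close>
  says exactly that it is a natural number; this is lemma \<open>ray_level_exists\<close>. As \<open>\<alpha>\<close> takes the
  \<open>\<epsilon>\<close>-component of \<open>x\<close> to that of \<open>\<alpha> x\<close> by the map \<open>\<Phi>\<close>, the level of the \<open>\<epsilon>\<close>-component of \<open>x\<close>
  grades \<open>S\<close> as required, and any element of the component \<open>x\<^sub>1\<close> has level 1.
\<close>

lemma cayley_function_if_graded:
  fixes l :: "'a \<Rightarrow> nat"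
  assumes closed: "\<alpha> \<in> S \<rightarrow> S"
    and inv: "\<And>x. x \<in> S \<Longrightarrow> \<alpha> x \<in> P \<longleftrightarrow> x \<in> P"
    and step: "\<And>x. x \<in> S \<Longrightarrow> x \<in> P \<Longrightarrow> l (\<alpha> x) = Suc (l x)"
    and one: "a \<in> S" "a \<in> P" "l a = 1"
  shows "cayley_function S \<alpha>"
proof -
  define mult where "mult x y = (if x \<in> P then (\<alpha> ^^ l x) y else x)" for x y
  have pow_S: "(\<alpha> ^^ n) x \<in> S" if "x \<in> S" for n x
    using that closed by (induction n) auto
  have pow_P: "(\<alpha> ^^ n) x \<in> P \<longleftrightarrow> x \<in> P" if "x \<in> S" for n x
    using that pow_S inv by (induction n) auto
  have pow_l: "l ((\<alpha> ^^ n) x) = n + l x" if "x \<in> S" "x \<in> P" for n x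
    using that pow_S pow_P step by (induction n) auto
  have "mult (mult x y) z = mult x (mult y z)" if "x \<in> S" "y \<in> S" "z \<in> S" for x y z
    using that by (auto simp: mult_def pow_P pow_l funpow_add)
  moreover have "mult x y \<in> S" if "x \<in> S" "y \<in> S" for x y
    using that pow_S by (auto simp: mult_def)
  moreover have "\<alpha> x = mult a x" for x
    using one by (simp add: mult_def)
  ultimately show ?thesis
    unfolding cayley_function_def using one(1) by (intro exI[of _ mult] bexI[of _ a]) auto
qed

section \<open>Levels along a right ray\<close>

text \<open>The number \<open>n\<close> is the index on the ray at which the orbit of \<open>d\<close> would have to start in
  order to move in step with the ray. Adding \<open>k\<close> to the index instead of subtracting it
  restricts levels to the natural numbers.\<close>

definition ray_level :: "('v \<Rightarrow> 'v) \<Rightarrow> (nat \<Rightarrow> 'v) \<Rightarrow> 'v \<Rightarrow> nat \<Rightarrow> bool" where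
  "ray_level \<beta> R d n \<longleftrightarrow> (\<exists>k. (\<beta> ^^ k) d = R (n + k))"

lemma verts_functional_digraph [simp]: "verts (functional_digraph X \<beta>) = X"
  by (simp add: functional_digraph_def)

lemma dominates_functional_digraph:
  "x \<rightarrow>\<^bsub>functional_digraph X \<beta>\<^esub> y \<longleftrightarrow> x \<in> X \<and> y \<in> X \<and> \<beta> x = y"
  by (auto simp: functional_digraph_def arcs_ends_conv)

lemma verts_component_of:
  "verts (component_of X \<beta> x) = {y \<in> X. \<exists>k m. (\<beta> ^^ k) y = (\<beta> ^^ m) x}"
  by (simp add: component_of_def)

lemma verts_join_of_branches:
  "verts (join_of_branches D R) = range R \<union> {y j |y m j. branch D R y m \<and> j \<le> m}"
proof -
  have "verts (join_of_branches D R) =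
      range R \<union> (\<Union>G\<in>{chain_digraph y m |y m. branch D R y m}. verts G)"
    by (simp add: join_of_branches_def pre_digraph.Union_def right_ray_digraph_def)
  also have "(\<Union>G\<in>{chain_digraph y m |y m. branch D R y m}. verts G) =
      \<Union>{verts (chain_digraph y m) |y m. branch D R y m}"
    by blast
  also have "\<dots> = \<Union>{y ` {..m} |y m. branch D R y m}"
    by (simp add: chain_digraph_def)
  also have "\<dots> = {y j |y m j. branch D R y m \<and> j \<le> m}"
    by blast
  finally show ?thesis .
qed

lemma funpow_right_ray:
  assumes "right_ray (functional_digraph X \<beta>) R"
  shows "(\<beta> ^^ k) (R i) = R (i + k)"
  using assms by (induction k) (auto simp: right_ray_def dominates_functional_digraph)

lemma funpow_chain:
  assumes "chain_in (functional_digraph X \<beta>) y m" "i + k \<le> m"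
  shows "(\<beta> ^^ k) (y i) = y (i + k)"
  using assms by (induction k) (auto simp: chain_in_def dominates_functional_digraph)

lemma ray_level_unique:
  assumes ray: "right_ray (functional_digraph X \<beta>) R"
    and "ray_level \<beta> R d n" "ray_level \<beta> R d n'"
  shows "n = n'"
proof -
  obtain k k' where k: "(\<beta> ^^ k) d = R (n + k)" and k': "(\<beta> ^^ k') d = R (n' + k')"
    using assms by (auto simp: ray_level_def)
  have "R (n + k + k') = (\<beta> ^^ (k' + k)) d"
    by (simp add: funpow_add k funpow_right_ray[OF ray])
  also have "\<dots> = (\<beta> ^^ (k + k')) d"
    by (simp add: add.commute)
  also have "\<dots> = R (n' + k' + k)"
    by (simp add: funpow_add k' funpow_right_ray[OF ray])
  finally have "n + k + k' = n' + k' + k"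
    using ray by (simp add: right_ray_def inj_eq)
  then show ?thesis by simp
qed

lemma ray_level_step:
  assumes ray: "right_ray (functional_digraph X \<beta>) R" and "ray_level \<beta> R d n"
  shows "ray_level \<beta> R (\<beta> d) (Suc n)"
proof -
  obtain k where k: "(\<beta> ^^ k) d = R (n + k)"
    using assms by (auto simp: ray_level_def)
  have "(\<beta> ^^ k) (\<beta> d) = \<beta> ((\<beta> ^^ k) d)"
    by (simp add: funpow_swap1)
  also have "\<dots> = R (Suc n + k)"
    using funpow_right_ray[OF ray, of 1 "n + k"] by (simp add: k)
  finally show ?thesis
    by (auto simp: ray_level_def)
qed

text \<open>Without the bound on the branches, a vertex could enter the ray at an index smaller
  than the number of steps it takes to get there. A bound for \<open>i \<ge> 1\<close> covers all branches,
  since the first vertex of a maximal ray has no predecessor and so no branch ends there.\<close>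

lemma ray_level_exists:
  assumes ray: "maximal_right_ray (functional_digraph X \<beta>) R"
    and join: "component_of X \<beta> c = join_of_branches (functional_digraph X \<beta>) R"
    and short: "\<forall>i\<ge>1. \<forall>y m. branch (functional_digraph X \<beta>) R y m \<and> y m = R i \<longrightarrow> m \<le> i"
    and d: "d \<in> X" "(\<beta> ^^ k) d = R n"
  shows "\<exists>n. ray_level \<beta> R d n"
proof -
  have rr: "right_ray (functional_digraph X \<beta>) R"
    using ray by (simp add: maximal_right_ray_def)
  have verts_C: "verts (component_of X \<beta> c) =
      range R \<union> {y j |y m j. branch (functional_digraph X \<beta>) R y m \<and> j \<le> m}"
    unfolding join by (rule verts_join_of_branches)
  then have "R 0 \<in> verts (component_of X \<beta> c)"
    by blast
  then obtain p q where "(\<beta> ^^ p) (R 0) = (\<beta> ^^ q) c"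
    by (auto simp: verts_component_of)
  then have "(\<beta> ^^ n) (R p) = (\<beta> ^^ (n + q)) c"
    by (simp add: funpow_add funpow_right_ray[OF rr])
  moreover have "(\<beta> ^^ (p + k)) d = (\<beta> ^^ n) (R p)"
    by (simp add: funpow_add d(2) funpow_right_ray[OF rr] add.commute[of n p])
  ultimately have "d \<in> verts (component_of X \<beta> c)"
    using d(1) unfolding verts_component_of mem_Collect_eq by metis
  then consider i where "d = R i"
    | y m j where "branch (functional_digraph X \<beta>) R y m" "j \<le> m" "d = y j"
    unfolding verts_C by blast
  then show ?thesis
  proof cases
    case 1
    then show ?thesis
      unfolding ray_level_def by (intro exI[of _ i] exI[of _ 0]) simp
  next
    case 2
    then have ch: "chain_in (functional_digraph X \<beta>) y m" and m: "m \<ge> 1" and "y m \<in> range R"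
      by (auto simp: branch_def)
    then obtain i where i: "y m = R i"
      by blast
    have "i \<noteq> 0"
    proof
      assume "i = 0"
      have "Suc (m - 1) = m" "m - 1 < m"
        using m by auto
      then have "y (m - 1) \<rightarrow>\<^bsub>functional_digraph X \<beta>\<^esub> y m"
        using ch unfolding chain_in_def by metis
      with \<open>i = 0\<close> i ray show False
        by (auto simp: maximal_right_ray_def initial_vertex_def)
    qed
    then have "m \<le> i"
      using short 2 i by simp
    moreover have "(\<beta> ^^ (m - j)) d = R i"
      using funpow_chain[OF ch, of j "m - j"] 2 i by simp
    ultimately have "ray_level \<beta> R d (i - (m - j))"
      by (auto simp: ray_level_def intro!: exI[of _ "m - j"])
    then show ?thesis ..
  qed
qed

section \<open>The map induced on the components of an idempotent\<close>

lemma verts_component_of_idempotent: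
  assumes "\<epsilon> \<in> S \<rightarrow> S" "\<forall>x\<in>S. \<epsilon> (\<epsilon> x) = \<epsilon> x" "x \<in> S"
  shows "verts (component_of S \<epsilon> x) = {y \<in> S. \<epsilon> y = \<epsilon> x}"
proof -
  have pow: "\<epsilon> ((\<epsilon> ^^ k) y) = \<epsilon> y" if "y \<in> S" for k y
  proof (induction k)
    case (Suc k)
    have "(\<epsilon> ^^ k) y \<in> S"
      using that assms(1) by (induction k) auto
    then show ?case
      using Suc assms(2) that by simp
  qed simp
  have "\<epsilon> y = \<epsilon> x" if "y \<in> S" "(\<epsilon> ^^ k) y = (\<epsilon> ^^ m) x" for y k m
    using pow[of y k] pow[of x m] that assms(3) by simp
  moreover have "\<exists>k m. (\<epsilon> ^^ k) y = (\<epsilon> ^^ m) x" if "\<epsilon> y = \<epsilon> x" for y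
    using that by (auto intro!: exI[of _ 1])
  ultimately show ?thesis
    unfolding verts_component_of by blast
qed

text \<open>The vertex sets of the components are the fibres of \<open>\<epsilon>\<close>. A map that commutes with \<open>\<epsilon>\<close>
  takes each fibre into a single one, and since a fibre is nonempty, that one is determined.\<close>

lemma induced_map_component_of:
  assumes \<epsilon>: "\<epsilon> \<in> S \<rightarrow> S" "\<forall>x\<in>S. \<epsilon> (\<epsilon> x) = \<epsilon> x"
    and \<alpha>: "\<alpha> \<in> S \<rightarrow> S" "\<forall>x\<in>S. \<alpha> (\<epsilon> x) = \<epsilon> (\<alpha> x)"
    and x: "x \<in> S"
  shows "induced_map S \<epsilon> \<alpha> (component_of S \<epsilon> x) = component_of S \<epsilon> (\<alpha> x)"
proof -
  note verts = verts_component_of_idempotent[OF \<epsilon>]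
  have \<alpha>x: "\<alpha> x \<in> S"
    using x \<alpha>(1) by blast
  show ?thesis
    unfolding induced_map_def
  proof (rule the_equality, intro conjI)
    show "component_of S \<epsilon> (\<alpha> x) \<in> components S \<epsilon>"
      using \<alpha>x by (simp add: components_def)
    have "\<epsilon> (\<alpha> y) = \<epsilon> (\<alpha> x)" if "y \<in> S" "\<epsilon> y = \<epsilon> x" for y
      using that \<alpha>(2) x by metis
    then show "\<alpha> ` verts (component_of S \<epsilon> x) \<subseteq> verts (component_of S \<epsilon> (\<alpha> x))"
      unfolding verts[OF x] verts[OF \<alpha>x] using \<alpha>(1) by blast
  next
    fix \<delta>
    assume \<delta>: "\<delta> \<in> components S \<epsilon> \<and> \<alpha> ` verts (component_of S \<epsilon> x) \<subseteq> verts \<delta>"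
    then obtain z where z: "z \<in> S" "\<delta> = component_of S \<epsilon> z"
      by (auto simp: components_def)
    have "x \<in> verts (component_of S \<epsilon> x)"
      using x by (simp add: verts)
    then have "\<alpha> x \<in> verts (component_of S \<epsilon> z)"
      using \<delta> z(2) by blast
    then have "\<epsilon> (\<alpha> x) = \<epsilon> z"
      by (simp add: verts[OF z(1)])
    then have "verts (component_of S \<epsilon> (\<alpha> x)) = verts \<delta>"
      using z \<alpha>x by (simp add: verts)
    \<comment> \<open>Components are induced subgraphs, so equal vertex sets give equal components.\<close>
    then show "\<delta> = component_of S \<epsilon> (\<alpha> x)"
      unfolding z(2) verts_component_of by (simp add: component_of_def)
  qed
qed

theorem theorem5:
  fixes S :: "'a set" and \<epsilon> \<alpha> :: "'a \<Rightarrow> 'a"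
  defines "C\<^sub>\<epsilon> \<equiv> components S \<epsilon>"
  defines "\<Phi> \<equiv> induced_map S \<epsilon> \<alpha>"
  assumes "infinite S"
    and "\<epsilon> \<in> S \<rightarrow> S" and "\<forall>x\<in>S. \<epsilon> (\<epsilon> x) = \<epsilon> x"
    and "\<alpha> \<in> S \<rightarrow> S" and "\<forall>x\<in>S. \<alpha> (\<epsilon> x) = \<epsilon> (\<alpha> x)"
    and "\<exists>C \<in> components C\<^sub>\<epsilon> \<Phi>. type_rro C"
    and "\<exists>C \<in> components C\<^sub>\<epsilon> \<Phi>. type_rro C \<and>
           (\<exists>R. maximal_right_ray (functional_digraph C\<^sub>\<epsilon> \<Phi>) R \<and>
                C = join_of_branches (functional_digraph C\<^sub>\<epsilon> \<Phi>) R \<and>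
                (\<forall>i\<ge>1. \<forall>y m. branch (functional_digraph C\<^sub>\<epsilon> \<Phi>) R y m \<and> y m = R i \<longrightarrow> m \<le> i))"
  shows "cayley_function S \<alpha>"
proof -
  obtain c R where ray: "maximal_right_ray (functional_digraph C\<^sub>\<epsilon> \<Phi>) R"
    and join: "component_of C\<^sub>\<epsilon> \<Phi> c = join_of_branches (functional_digraph C\<^sub>\<epsilon> \<Phi>) R"
    and short: "\<forall>i\<ge>1. \<forall>y m. branch (functional_digraph C\<^sub>\<epsilon> \<Phi>) R y m \<and> y m = R i \<longrightarrow> m \<le> i"
    using assms(9) unfolding components_def[of C\<^sub>\<epsilon>] by blast
  have rr: "right_ray (functional_digraph C\<^sub>\<epsilon> \<Phi>) R"
    using ray by (simp add: maximal_right_ray_def)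
  define K where "K = component_of S \<epsilon>"
  have \<Phi>_K: "\<Phi> (K x) = K (\<alpha> x)" if "x \<in> S" for x
    unfolding \<Phi>_def K_def by (rule induced_map_component_of[OF assms(4-7) that])
  have K_in: "K x \<in> C\<^sub>\<epsilon>" if "x \<in> S" for x
    using that by (simp add: K_def C\<^sub>\<epsilon>_def components_def)
  define P where "P = {x. \<exists>n. ray_level \<Phi> R (K x) n}"
  define l where "l x = (THE n. ray_level \<Phi> R (K x) n)" for x
  have l_eq: "l x = n" if "ray_level \<Phi> R (K x) n" for x n
    unfolding l_def using that ray_level_unique[OF rr] by blast
  have step: "ray_level \<Phi> R (K (\<alpha> x)) (Suc n)" if "x \<in> S" "ray_level \<Phi> R (K x) n" for x n
    using ray_level_step[OF rr that(2)] \<Phi>_K[OF that(1)] by simp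
  have pred: "\<exists>n. ray_level \<Phi> R (K x) n" if "x \<in> S" "ray_level \<Phi> R (K (\<alpha> x)) n" for x n
  proof -
    have "ray_level \<Phi> R (\<Phi> (K x)) n"
      using that \<Phi>_K by simp
    then obtain k where "(\<Phi> ^^ k) (\<Phi> (K x)) = R (n + k)"
      by (auto simp: ray_level_def)
    then have "(\<Phi> ^^ Suc k) (K x) = R (n + k)"
      by (simp add: funpow_swap1)
    then show ?thesis
      by (rule ray_level_exists[OF ray join short K_in[OF that(1)]])
  qed
  have "R 1 \<in> C\<^sub>\<epsilon>"
    using rr by (auto simp: right_ray_def)
  then obtain a where a: "a \<in> S" "K a = R 1"
    by (auto simp: K_def C\<^sub>\<epsilon>_def components_def)
  then have lev_a: "ray_level \<Phi> R (K a) 1"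
    by (auto simp: ray_level_def intro!: exI[of _ 0])
  show ?thesis
  proof (rule cayley_function_if_graded)
    show "\<alpha> \<in> S \<rightarrow> S" by fact
    show "\<alpha> x \<in> P \<longleftrightarrow> x \<in> P" if "x \<in> S" for x
      using step[OF that] pred[OF that] by (auto simp: P_def)
    show "l (\<alpha> x) = Suc (l x)" if "x \<in> S" "x \<in> P" for x
      using that step l_eq by (auto simp: P_def)
    show "a \<in> S" "a \<in> P" "l a = 1"
      using a lev_a l_eq by (auto simp: P_def)
  qed
qed

end
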